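(* Consider a bipartite Bell scenario with settings $x\in\{x_1,x_2\}$ for Alice, $y\in\{y_1,y_2\}$ for Bob, and outcomes $a,b\in\{+1,-1\}$. The AMP tilted Bell expression, with parameters $\alpha$ and $\beta$, $$I_\alpha^\beta=\beta\langle x_1\rangle+\alpha\langle x_1y_1\rangle+\alpha\langle x_1y_2\rangle+\langle x_2y_1\rangle-\langle x_2y_2\rangle,$$ in the presence of locality and relaxed measurement independence, is bounded by $$I_\alpha^\beta\le \beta+2\alpha+\min\{\alpha(M_1+\min\{M_1,M_2\})+M_2,\;2\},$$ where $M_1$ and $M_2$ are the measurement dependence parameters for Alice and Bob.
   Context: The statistics are described by a hidden-variable model: a hidden-variable space $\Lambda$, a probability density $p(\lambda|x,y)$ on $\Lambda$ for each pair of settings $(x,y)$ (with respect to a common measure $\mathrm{d}\lambda$), and response probabilities $p(ab|xy\lambda)$, with $p(ab|xy)=\int \mathrm{d}\lambda\,p(ab|xy\lambda)\,p(\lambda|x,y)$. Locality: $p(ab|xy\lambda)=p(a|x\lambda)\,p(b|y\lambda)$ for all $a,b,x,y,\lambda$. Measurement independence would mean $p(\lambda|x,y)=p(\lambda)$ for all $x,y$. Relaxing it means that $p(\lambda|x,y)$ may depend on $(x,y)$; the amount of dependence is quantified by $$M_1=\max\Big\{\int \mathrm{d}\lambda\,|p(\lambda|x_1,y_1)-p(\lambda|x_2,y_1)|,\ \int \mathrm{d}\lambda\,|p(\lambda|x_1,y_2)-p(\lambda|x_2,y_2)|\Big\},$$ $$M_2=\max\Big\{\int \mathrm{d}\lambda\,|p(\lambda|x_1,y_1)-p(\lambda|x_1,y_2)|,\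 \int \mathrm{d}\lambda\,|p(\lambda|x_2,y_1)-p(\lambda|x_2,y_2)|\Big\}.$$ Correlators: $\langle xy\rangle=\sum_{a,b}ab\,p(ab|xy)$, and $\langle x\rangle=\int \mathrm{d}\lambda\,p(\lambda|x)\sum_a a\,p(a|x\lambda)$, where $p(\lambda|x)$ is the (normalised) distribution of $\lambda$ conditioned on Alice's setting. Without measurement dependence, the AMP tilted Bell inequality reads $I_\alpha^\beta\le\beta+2\alpha$.
   Formalization: The parameters are restricted to α ≥ 1 and β ≥ 0; outside this range the bound already fails for M₁ = M₂ = 0, since local models reach |β| + 2max(|α|,1) (e.g. α = β = 0 gives I = 2 > 0). *)

theory Defs
  imports "HOL-Analysis.Analysis"
begin

datatype alice_setting = X1 | X2

datatype bob_setting = Y1 | Y2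

definition outcomes :: "real set" where
  "outcomes = {1, -1}"

text \<open>
  A hidden-variable model for the scenario: \<open>L\<close> is the hidden-variable space with its common
  reference measure, \<open>\<rho> x y l\<close> is \<open>p(l|x,y)\<close>, and \<open>P a b x y l\<close> is \<open>p(ab|xyl)\<close>.
  The weights \<open>\<pi> x y\<close> are the probabilities \<open>p(y|x)\<close> of Bob's setting given Alice's; they are
  arbitrary and enter only through the distribution of \<open>l\<close> conditioned on Alice's setting alone.
\<close>

locale hidden_variable_model =
  fixes L :: "'l measure"
    and \<rho> :: "alice_setting \<Rightarrow> bob_setting \<Rightarrow> 'l \<Rightarrow> real"
    and P :: "real \<Rightarrow> real \<Rightarrow> alice_setting \<Rightarrow> bob_setting \<Rightarrow> 'l \<Rightarrow> real"
    and \<pi> :: "alice_setting \<Rightarrow> bob_setting \<Rightarrow> real"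
  assumes density_nonneg: "\<And>x y l. l \<in> space L \<Longrightarrow> 0 \<le> \<rho> x y l"
    and density_integrable: "\<And>x y. integrable L (\<rho> x y)"
    and density_normalised: "\<And>x y. (LINT l|L. \<rho> x y l) = 1"
    and response_measurable:
      "\<And>a b x y. a \<in> outcomes \<Longrightarrow> b \<in> outcomes \<Longrightarrow> P a b x y \<in> borel_measurable L"
    and response_nonneg:
      "\<And>a b x y l. a \<in> outcomes \<Longrightarrow> b \<in> outcomes \<Longrightarrow> l \<in> space L \<Longrightarrow> 0 \<le> P a b x y l"
    and response_normalised:
      "\<And>x y l. l \<in> space L \<Longrightarrow> (\<Sum>a\<in>outcomes. \<Sum>b\<in>outcomes. P a b x y l) = 1"
    and setting_nonneg: "\<And>x y. 0 \<le> \<pi> x y"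
    and setting_normalised: "\<And>x. (\<Sum>y\<in>{Y1, Y2}. \<pi> x y) = 1"

text \<open>
  In the next definition \<open>PA a x l\<close> is \<open>p(a|xl)\<close> and \<open>PB b y l\<close> is \<open>p(b|yl)\<close>. Their measurability
  in \<open>l\<close> is not required separately: each is a marginal of the measurable joint response.
\<close>

definition locality ::
  "'l measure \<Rightarrow> (real \<Rightarrow> real \<Rightarrow> alice_setting \<Rightarrow> bob_setting \<Rightarrow> 'l \<Rightarrow> real) \<Rightarrow>
   (real \<Rightarrow> alice_setting \<Rightarrow> 'l \<Rightarrow> real) \<Rightarrow> (real \<Rightarrow> bob_setting \<Rightarrow> 'l \<Rightarrow> real) \<Rightarrow> bool" where
  "locality L P PA PB \<longleftrightarrow>
     (\<forall>l\<in>space L.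
        (\<forall>x. (\<forall>a\<in>outcomes. 0 \<le> PA a x l) \<and> (\<Sum>a\<in>outcomes. PA a x l) = 1) \<and>
        (\<forall>y. (\<forall>b\<in>outcomes. 0 \<le> PB b y l) \<and> (\<Sum>b\<in>outcomes. PB b y l) = 1) \<and>
        (\<forall>a\<in>outcomes. \<forall>b\<in>outcomes. \<forall>x y. P a b x y l = PA a x l * PB b y l))"

definition observed_prob ::
  "'l measure \<Rightarrow> (alice_setting \<Rightarrow> bob_setting \<Rightarrow> 'l \<Rightarrow> real) \<Rightarrow>
   (real \<Rightarrow> real \<Rightarrow> alice_setting \<Rightarrow> bob_setting \<Rightarrow> 'l \<Rightarrow> real) \<Rightarrow>
   real \<Rightarrow> real \<Rightarrow> alice_setting \<Rightarrow> bob_setting \<Rightarrow> real" where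
  "observed_prob L \<rho> P a b x y = (LINT l|L. P a b x y l * \<rho> x y l)"

definition correlator ::
  "'l measure \<Rightarrow> (alice_setting \<Rightarrow> bob_setting \<Rightarrow> 'l \<Rightarrow> real) \<Rightarrow>
   (real \<Rightarrow> real \<Rightarrow> alice_setting \<Rightarrow> bob_setting \<Rightarrow> 'l \<Rightarrow> real) \<Rightarrow>
   alice_setting \<Rightarrow> bob_setting \<Rightarrow> real" where
  "correlator L \<rho> P x y = (\<Sum>a\<in>outcomes. \<Sum>b\<in>outcomes. a * b * observed_prob L \<rho> P a b x y)"

definition alice_density ::
  "(alice_setting \<Rightarrow> bob_setting \<Rightarrow> 'l \<Rightarrow> real) \<Rightarrow> (alice_setting \<Rightarrow> bob_setting \<Rightarrow> real) \<Rightarrow>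
   alice_setting \<Rightarrow> 'l \<Rightarrow> real" where
  "alice_density \<rho> \<pi> x l = (\<Sum>y\<in>{Y1, Y2}. \<pi> x y * \<rho> x y l)"

definition alice_mean ::
  "'l measure \<Rightarrow> (alice_setting \<Rightarrow> bob_setting \<Rightarrow> 'l \<Rightarrow> real) \<Rightarrow>
   (alice_setting \<Rightarrow> bob_setting \<Rightarrow> real) \<Rightarrow> (real \<Rightarrow> alice_setting \<Rightarrow> 'l \<Rightarrow> real) \<Rightarrow>
   alice_setting \<Rightarrow> real" where
  "alice_mean L \<rho> \<pi> PA x =
     (LINT l|L. alice_density \<rho> \<pi> x l * (\<Sum>a\<in>outcomes. a * PA a x l))"

definition M_Alice ::
  "'l measure \<Rightarrow> (alice_setting \<Rightarrow> bob_setting \<Rightarrow> 'l \<Rightarrow> real) \<Rightarrow> real" where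
  "M_Alice L \<rho> = max (LINT l|L. \<bar>\<rho> X1 Y1 l - \<rho> X2 Y1 l\<bar>) (LINT l|L. \<bar>\<rho> X1 Y2 l - \<rho> X2 Y2 l\<bar>)"

definition M_Bob ::
  "'l measure \<Rightarrow> (alice_setting \<Rightarrow> bob_setting \<Rightarrow> 'l \<Rightarrow> real) \<Rightarrow> real" where
  "M_Bob L \<rho> = max (LINT l|L. \<bar>\<rho> X1 Y1 l - \<rho> X1 Y2 l\<bar>) (LINT l|L. \<bar>\<rho> X2 Y1 l - \<rho> X2 Y2 l\<bar>)"

definition AMP ::
  "real \<Rightarrow> real \<Rightarrow> 'l measure \<Rightarrow> (alice_setting \<Rightarrow> bob_setting \<Rightarrow> 'l \<Rightarrow> real) \<Rightarrow>
   (real \<Rightarrow> real \<Rightarrow> alice_setting \<Rightarrow> bob_setting \<Rightarrow> 'l \<Rightarrow> real) \<Rightarrow>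
   (alice_setting \<Rightarrow> bob_setting \<Rightarrow> real) \<Rightarrow> (real \<Rightarrow> alice_setting \<Rightarrow> 'l \<Rightarrow> real) \<Rightarrow> real" where
  "AMP \<alpha> \<beta> L \<rho> P \<pi> PA =
     \<beta> * alice_mean L \<rho> \<pi> PA X1 + \<alpha> * correlator L \<rho> P X1 Y1 + \<alpha> * correlator L \<rho> P X1 Y2
     + correlator L \<rho> P X2 Y1 - correlator L \<rho> P X2 Y2"

end

theory Submission
  imports Defs
begin

text \<open>
  Given \<open>l\<close>, the correlators factorise into local means in \<open>[-1, 1]\<close>. Split off from the four
  densities their pointwise minimum \<open>m\<close>: on this common part the CHSH bound \<open>2 m\<close> applies, on the
  remainder only the trivial bound. This leaves an excess governed by the total mass minus
  \<open>2 m\<close>, and \<open>2 m\<close> is at least the sum of the end values minus the total variation along any path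
  through the four setting pairs. Using three sides of the square of setting pairs as the path, the
  excess is at most \<open>2 M\<^sub>1 + M\<^sub>2\<close>, and likewise at most \<open>M\<^sub>1 + 2 M\<^sub>2\<close>; both suffice because
  \<open>\<alpha> \<ge> 1\<close>.
\<close>

lemma sum_outcomes [simp]: "(\<Sum>a\<in>outcomes. f a) = f 1 + f (- 1)"
  by (simp add: outcomes_def)

text \<open>The expected outcome given \<open>l\<close>; the setting type is left polymorphic so
  that \<open>PA\<close> and \<open>PB\<close> share it.\<close>

definition local_mean :: "(real \<Rightarrow> 's \<Rightarrow> 'l \<Rightarrow> real) \<Rightarrow> 's \<Rightarrow> 'l \<Rightarrow> real" where
  "local_mean Q s l = (\<Sum>a\<in>outcomes. a * Q a s l)"

lemma mult_le_abs:
  fixes t x :: real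
  assumes "\<bar>t\<bar> \<le> 1"
  shows "t * x \<le> \<bar>x\<bar>"
  using mult_right_mono[OF assms abs_ge_zero[of x]] abs_ge_self[of "t * x"] by (simp add: abs_mult)

text \<open>Grouping by \<open>a\<close> and \<open>b\<close> leaves
  \<open>\<bar>c + d\<bar> + \<bar>c - d\<bar>\<close>, which is twice the larger of
  \<open>\<bar>c\<bar>\<close> and \<open>\<bar>d\<bar>\<close>.\<close>

lemma CHSH_le_2:
  fixes a b c d :: real
  assumes "\<bar>a\<bar> \<le> 1" "\<bar>b\<bar> \<le> 1" "\<bar>c\<bar> \<le> 1" "\<bar>d\<bar> \<le> 1"
  shows "a * c + a * d + b * c - b * d \<le> 2"
proof -
  have "a * (c + d) \<le> \<bar>c + d\<bar>" "b * (c - d) \<le> \<bar>c - d\<bar>"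
    using assms by (simp_all add: mult_le_abs)
  moreover have "\<bar>c + d\<bar> + \<bar>c - d\<bar> \<le> 2"
    using assms by linarith
  ultimately show ?thesis
    by (simp add: algebra_simps)
qed

lemma abs_mult_le_1:
  fixes a b :: real
  shows "\<bar>a\<bar> \<le> 1 \<Longrightarrow> \<bar>b\<bar> \<le> 1 \<Longrightarrow> \<bar>a * b\<bar> \<le> 1"
  by (simp add: abs_mult mult_le_one)

lemma weighted_CHSH_le:
  fixes a b c d p q r s m \<alpha> :: real
  assumes abcd: "\<bar>a\<bar> \<le> 1" "\<bar>b\<bar> \<le> 1" "\<bar>c\<bar> \<le> 1" "\<bar>d\<bar> \<le> 1"
    and m: "0 \<le> m" "m \<le> p" "m \<le> q" "m \<le> r" "m \<le> s"
    and \<alpha>: "\<alpha> \<ge> 1"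
  shows "\<alpha> * (p * (a * c)) + \<alpha> * (q * (a * d)) + r * (b * c) - s * (b * d)
    \<le> \<alpha> * (p + q) + r + s - 2 * m"
proof -
  have "m * (a * c + a * d + b * c - b * d) \<le> m * 2"
    using CHSH_le_2[OF abcd] m by (intro mult_left_mono) auto
  moreover have "(a * c) * (\<alpha> * p - m) \<le> \<bar>\<alpha> * p - m\<bar>" "(a * d) * (\<alpha> * q - m) \<le> \<bar>\<alpha> * q - m\<bar>"
    "(b * c) * (r - m) \<le> \<bar>r - m\<bar>" "(- b * d) * (s - m) \<le> \<bar>s - m\<bar>"
    using abcd by (intro mult_le_abs abs_mult_le_1; simp)+
  \<comment> \<open>With \<alpha> at least 1 the remaining weights are nonnegative, so the absolute
    values above drop. They add up to the total weight minus \<open>4 * m\<close>, and the CHSH part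
    gives back \<open>2 * m\<close>.\<close>
  moreover have "m \<le> \<alpha> * p" "m \<le> \<alpha> * q"
    using mult_mono[of 1 \<alpha> m p] mult_mono[of 1 \<alpha> m q] m \<alpha> by auto
  ultimately show ?thesis
    using m by (simp add: algebra_simps)
qed

context
  fixes L :: "'l measure" and \<rho> P \<pi> PA PB
  assumes model: "hidden_variable_model L \<rho> P \<pi>"
    and local: "locality L P PA PB"
begin

interpretation hidden_variable_model L \<rho> P \<pi>
  by (fact model)

lemma abs_local_mean_le_1:
  assumes "l \<in> space L"
  shows "\<bar>local_mean PA x l\<bar> \<le> 1" "\<bar>local_mean PB y l\<bar> \<le> 1"
proof -
  have "0 \<le> PA 1 x l" "0 \<le> PA (-1) x l" "PA 1 x l + PA (-1) x l = 1"
    "0 \<le> PB 1 y l" "0 \<le> PB (-1) y l" "PB 1 y l + PB (-1) y l = 1"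
    using local assms by (auto simp: locality_def outcomes_def)
  then show "\<bar>local_mean PA x l\<bar> \<le> 1" "\<bar>local_mean PB y l\<bar> \<le> 1"
    by (auto simp: local_mean_def)
qed

lemma joint_response_integrable:
  assumes ab: "a \<in> outcomes" "b \<in> outcomes"
  shows "integrable L (\<lambda>l. P a b x y l * \<rho> x y l)"
proof (rule Bochner_Integration.integrable_bound[OF density_integrable])
  show "(\<lambda>l. P a b x y l * \<rho> x y l) \<in> borel_measurable L"
    using response_measurable[OF ab, of x y] borel_measurable_integrable[OF density_integrable[of x y]]
    by measurable
  have "norm (P a b x y l * \<rho> x y l) \<le> norm (\<rho> x y l)" if l: "l \<in> space L" for l
  proof -
    have "P a b x y l \<le> 1"
      using response_normalised[OF l, of x y] ab response_nonneg[OF _ _ l, of 1 1 x y]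
        response_nonneg[OF _ _ l, of 1 "-1" x y] response_nonneg[OF _ _ l, of "-1" 1 x y]
        response_nonneg[OF _ _ l, of "-1" "-1" x y]
      by (auto simp: outcomes_def)
    then show ?thesis
      using response_nonneg[OF ab l] density_nonneg[OF l] by (simp add: mult_left_le_one_le)
  qed
  then show "AE l in L. norm (P a b x y l * \<rho> x y l) \<le> norm (\<rho> x y l)"
    by auto
qed

text \<open>Locality factorises the sum over outcomes pointwise. Integrability is carried over from
  the joint responses, for which measurability is assumed.\<close>

lemma correlator_integral:
  shows integrable_correlator:
      "integrable L (\<lambda>l. \<rho> x y l * (local_mean PA x l * local_mean PB y l))" (is ?int)
    and correlator_eq:
      "correlator L \<rho> P x y = (LINT l|L. \<rho> x y l * (local_mean PA x l * local_mean PB y l))" (is ?eq)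
proof -
  have out: "1 \<in> outcomes" "-1 \<in> outcomes"
    by (simp_all add: outcomes_def)
  let ?f = "\<lambda>l. \<Sum>a\<in>outcomes. \<Sum>b\<in>outcomes. a * b * (P a b x y l * \<rho> x y l)"
  have f: "?f l = \<rho> x y l * (local_mean PA x l * local_mean PB y l)" if "l \<in> space L" for l
  proof -
    have "P a b x y l = PA a x l * PB b y l" if "a \<in> outcomes" "b \<in> outcomes" for a b
      using local that \<open>l \<in> space L\<close> by (simp add: locality_def)
    then show ?thesis
      using out by (simp add: local_mean_def algebra_simps)
  qed
  have int_f: "integrable L ?f"
    using joint_response_integrable out
    by (intro Bochner_Integration.integrable_sum integrable_mult_right) auto
  then show ?int
    using f by (subst (asm) Bochner_Integration.integrable_cong) auto
  have "correlator L \<rho> P x y = integral\<^sup>L L ?f"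
    using joint_response_integrable out
    by (simp add: correlator_def observed_prob_def)
  also have "\<dots> = (LINT l|L. \<rho> x y l * (local_mean PA x l * local_mean PB y l))"
    using f by (intro Bochner_Integration.integral_cong) auto
  finally show ?eq .
qed

text \<open>Integrates the pointwise bound, with \<open>g\<close> in place of twice the minimum: a
  minorant with a known integral turns this into an explicit bound.\<close>

lemma correlators_le_of_minorant:
  assumes \<alpha>: "\<alpha> \<ge> 1"
    and int: "integrable L g"
    and g: "\<And>l m. \<lbrakk>l \<in> space L; m = Min {\<rho> X1 Y1 l, \<rho> X1 Y2 l, \<rho> X2 Y1 l, \<rho> X2 Y2 l}\<rbrakk>
      \<Longrightarrow> g l \<le> 2 * m"
  shows "\<alpha> * correlator L \<rho> P X1 Y1 + \<alpha> * correlator L \<rho> P X1 Y2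
      + correlator L \<rho> P X2 Y1 - correlator L \<rho> P X2 Y2
    \<le> 2 * \<alpha> + 2 - integral\<^sup>L L g"
proof -
  let ?c = "\<lambda>x y l. \<rho> x y l * (local_mean PA x l * local_mean PB y l)"
  have "\<alpha> * correlator L \<rho> P X1 Y1 + \<alpha> * correlator L \<rho> P X1 Y2
      + correlator L \<rho> P X2 Y1 - correlator L \<rho> P X2 Y2
    = (LINT l|L. \<alpha> * ?c X1 Y1 l + \<alpha> * ?c X1 Y2 l + ?c X2 Y1 l - ?c X2 Y2 l)"
    by (simp add: correlator_eq integrable_correlator)
  also have "\<dots> \<le> (LINT l|L. \<alpha> * (\<rho> X1 Y1 l + \<rho> X1 Y2 l) + \<rho> X2 Y1 l + \<rho> X2 Y2 l - g l)"
  proof (rule integral_mono)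
    fix l assume l: "l \<in> space L"
    let ?m = "Min {\<rho> X1 Y1 l, \<rho> X1 Y2 l, \<rho> X2 Y1 l, \<rho> X2 Y2 l}"
    have "\<alpha> * ?c X1 Y1 l + \<alpha> * ?c X1 Y2 l + ?c X2 Y1 l - ?c X2 Y2 l
      \<le> \<alpha> * (\<rho> X1 Y1 l + \<rho> X1 Y2 l) + \<rho> X2 Y1 l + \<rho> X2 Y2 l - 2 * ?m"
      using \<alpha> abs_local_mean_le_1[OF l] density_nonneg[OF l]
      by (intro weighted_CHSH_le) auto
    with g[OF l refl]
    show "\<alpha> * ?c X1 Y1 l + \<alpha> * ?c X1 Y2 l + ?c X2 Y1 l - ?c X2 Y2 l
      \<le> \<alpha> * (\<rho> X1 Y1 l + \<rho> X1 Y2 l) + \<rho> X2 Y1 l + \<rho> X2 Y2 l - g l"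
      by linarith
  qed (auto intro!: integrable_correlator density_integrable int
      Bochner_Integration.integrable_add Bochner_Integration.integrable_diff integrable_mult_right)
  also have "\<dots> = 2 * \<alpha> + 2 - integral\<^sup>L L g"
    by (simp add: density_integrable density_normalised int)
  finally show ?thesis .
qed

text \<open>Equality of the two sets makes the path visit every setting pair exactly once. In the
  minorant the two end densities integrate to 2 in total, which cancels the trivial excess 2 and
  leaves only the variation.\<close>

lemma correlators_le_path:
  assumes \<alpha>: "\<alpha> \<ge> 1"
    and path: "{(x1, y1), (x2, y2), (x3, y3), (x4, y4)} = {(X1, Y1), (X1, Y2), (X2, Y1), (X2, Y2)}"
  shows "\<alpha> * correlator L \<rho> P X1 Y1 + \<alpha> * correlator L \<rho> P X1 Y2
      + correlator L \<rho> P X2 Y1 - correlator L \<rho> P X2 Y2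
    \<le> 2 * \<alpha> + (LINT l|L. \<bar>\<rho> x1 y1 l - \<rho> x2 y2 l\<bar>) + (LINT l|L. \<bar>\<rho> x2 y2 l - \<rho> x3 y3 l\<bar>)
      + (LINT l|L. \<bar>\<rho> x3 y3 l - \<rho> x4 y4 l\<bar>)"
proof -
  let ?g = "\<lambda>l. \<rho> x1 y1 l + \<rho> x4 y4 l - \<bar>\<rho> x1 y1 l - \<rho> x2 y2 l\<bar> - \<bar>\<rho> x2 y2 l - \<rho> x3 y3 l\<bar>
    - \<bar>\<rho> x3 y3 l - \<rho> x4 y4 l\<bar>"
  have int: "integrable L ?g"
    by (intro Bochner_Integration.integrable_add Bochner_Integration.integrable_diff
        integrable_abs density_integrable)
  have "?g l \<le> 2 * m" if m: "m = Min {\<rho> X1 Y1 l, \<rho> X1 Y2 l, \<rho> X2 Y1 l, \<rho> X2 Y2 l}" for l m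
  proof -
    have "{\<rho> X1 Y1 l, \<rho> X1 Y2 l, \<rho> X2 Y1 l, \<rho> X2 Y2 l}
      = {\<rho> x1 y1 l, \<rho> x2 y2 l, \<rho> x3 y3 l, \<rho> x4 y4 l}"
      using arg_cong[OF path, of "image (\<lambda>(x, y). \<rho> x y l)"] by simp
    then have "m \<in> {\<rho> x1 y1 l, \<rho> x2 y2 l, \<rho> x3 y3 l, \<rho> x4 y4 l}"
      unfolding m by (metis Min_in finite.emptyI finite.insertI insert_not_empty)
    \<comment> \<open>Wherever on the path \<open>m\<close> is attained, the variation covers the
      way from the first value to \<open>m\<close> and from \<open>m\<close> to the last.\<close>
    then show ?thesis
      by auto
  qed
  from correlators_le_of_minorant[OF \<alpha> int this] show ?thesis
    by (simp add: density_integrable density_normalised)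
qed

lemma correlators_le_M:
  assumes "\<alpha> \<ge> 1"
  shows "\<alpha> * correlator L \<rho> P X1 Y1 + \<alpha> * correlator L \<rho> P X1 Y2
      + correlator L \<rho> P X2 Y1 - correlator L \<rho> P X2 Y2
    \<le> 2 * \<alpha> + M_Alice L \<rho> + M_Bob L \<rho> + min (M_Alice L \<rho>) (M_Bob L \<rho>)"
  \<comment> \<open>The first path changes Alice's setting, then Bob's, then Alice's; the second
    changes Bob's, then Alice's, then Bob's.\<close>
  using correlators_le_path[OF assms, of X1 Y1 X2 Y1 X2 Y2 X1 Y2]
    correlators_le_path[OF assms, of X1 Y2 X1 Y1 X2 Y1 X2 Y2]
  unfolding M_Alice_def M_Bob_def
  by (simp add: insert_commute abs_minus_commute)

lemma correlators_le_trivial: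
  assumes "\<alpha> \<ge> 1"
  shows "\<alpha> * correlator L \<rho> P X1 Y1 + \<alpha> * correlator L \<rho> P X1 Y2
      + correlator L \<rho> P X2 Y1 - correlator L \<rho> P X2 Y2 \<le> 2 * \<alpha> + 2"
  \<comment> \<open>Nonnegative densities admit the minorant 0.\<close>
  using correlators_le_of_minorant[OF assms, of "\<lambda>_. 0"] density_nonneg by simp

lemma alice_mean_le_1: "alice_mean L \<rho> \<pi> PA x \<le> 1"
proof -
  have int: "integrable L (alice_density \<rho> \<pi> x)"
    unfolding alice_density_def
    by (intro Bochner_Integration.integrable_sum integrable_mult_right density_integrable)
  have nonneg: "0 \<le> alice_density \<rho> \<pi> x l" if "l \<in> space L" for l
    unfolding alice_density_def using that density_nonneg setting_nonneg by (intro sum_nonneg) simp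
  have "alice_mean L \<rho> \<pi> PA x \<le> integral\<^sup>L L (alice_density \<rho> \<pi> x)"
    unfolding alice_mean_def
  \<comment> \<open>Integrability is asked only of the dominating density. A non-integrable left
    side would have integral 0 by convention, which is why the density must be nonnegative.\<close>
  proof (rule integral_mono'[OF int])
    fix l assume l: "l \<in> space L"
    show "alice_density \<rho> \<pi> x l * (\<Sum>a\<in>outcomes. a * PA a x l) \<le> alice_density \<rho> \<pi> x l"
      using mult_le_abs[OF abs_local_mean_le_1(1)[OF l, of x], of "alice_density \<rho> \<pi> x l"] nonneg[OF l]
      by (simp add: local_mean_def mult.commute)
  qed (fact nonneg)
  also have "\<dots> = 1"
    using setting_normalised[of x]
    by (simp add: alice_density_def[abs_def] density_integrable density_normalised)
  finally show ?thesis .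
qed

end

theorem proposition1:
  fixes L :: "'l measure"
    and \<rho> :: "alice_setting \<Rightarrow> bob_setting \<Rightarrow> 'l \<Rightarrow> real"
    and P :: "real \<Rightarrow> real \<Rightarrow> alice_setting \<Rightarrow> bob_setting \<Rightarrow> 'l \<Rightarrow> real"
    and \<pi> :: "alice_setting \<Rightarrow> bob_setting \<Rightarrow> real"
    and PA :: "real \<Rightarrow> alice_setting \<Rightarrow> 'l \<Rightarrow> real"
    and PB :: "real \<Rightarrow> bob_setting \<Rightarrow> 'l \<Rightarrow> real"
    and \<alpha> \<beta> :: real
  assumes "hidden_variable_model L \<rho> P \<pi>"
    and "locality L P PA PB"
    and "\<alpha> \<ge> 1" and "\<beta> \<ge> 0"
  shows "AMP \<alpha> \<beta> L \<rho> P \<pi> PA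
    \<le> \<beta> + 2 * \<alpha> + min (\<alpha> * (M_Alice L \<rho> + min (M_Alice L \<rho>) (M_Bob L \<rho>)) + M_Bob L \<rho>) 2"
proof -
  have "\<beta> * alice_mean L \<rho> \<pi> PA X1 \<le> \<beta>"
    using mult_left_mono[OF alice_mean_le_1[OF assms(1,2)] assms(4)] by simp
  moreover have "0 \<le> M_Alice L \<rho>" "0 \<le> M_Bob L \<rho>"
    by (simp_all add: M_Alice_def M_Bob_def le_max_iff_disj)
  \<comment> \<open>A nonnegative quantity can only grow under the factor \<alpha>; adding
    \<open>M_Bob L \<rho>\<close> to both sides turns the bound of \<open>correlators_le_M\<close>
    into the first entry of the outer minimum.\<close>
  then have "M_Alice L \<rho> + min (M_Alice L \<rho>) (M_Bob L \<rho>)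
    \<le> \<alpha> * (M_Alice L \<rho> + min (M_Alice L \<rho>) (M_Bob L \<rho>))"
    using mult_right_mono[OF assms(3)] by fastforce
  ultimately show ?thesis
    using correlators_le_M[OF assms(1-3)] correlators_le_trivial[OF assms(1-3)]
    unfolding AMP_def by linarith
qed

end
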